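(* Let $n\ge 1$. A word $w$ over $[n]$ fixes all $n$-component acyclic networks if and only if $w$ is $n$-complete. Hence $\lambda_A(n)=\lambda(n)$.
   Context: An $n$-component (Boolean) network is a function $f=(f_1,\dots,f_n):\{0,1\}^n\to\{0,1\}^n$. Write $[n]=\{1,\dots,n\}$. The interaction graph of $f$ is the directed graph on $[n]$ (loops allowed) with an edge from $j$ to $i$ iff there exist $x,y$ differing only in component $j$ with $f_i(x)\ne f_i(y)$; $f$ is acyclic if its interaction graph has no directed cycle (in particular no loop). For $i\in[n]$, $f^i(x):=(x_1,\dots,x_{i-1},f_i(x),x_{i+1},\dots,x_n)$, and for a word $w=i_1\dots i_k$ over $[n]$, $f^w:=f^{i_k}\circ\cdots\circ f^{i_1}$ (identity for the empty word). A word $w$ fixes $f$ if $f^w(x)$ is a fixed point of $f$ for every $x$. $\lambda_A(n)$ is the minimum length of a single word fixing all $n$-component acyclic networks. A word is $n$-complete if it contains every permutation of $[n]$ (viewed as a word using each letter once) as a (not necessarily contiguous) subsequence; $\lambda(n)$ is the length of a shortest $n$-complete word. *)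

theory Defs
  imports "HOL-Library.FuncSet" "HOL-Library.Sublist" "HOL-Combinatorics.Multiset_Permutations"
begin

text \<open>
  Configurations are Boolean functions on \<open>{1..n}\<close>, made extensional so that equality of
  configurations is equality of their \<open>n\<close> components.
\<close>

definition configs :: "nat \<Rightarrow> (nat \<Rightarrow> bool) set" where
  "configs n = {1..n} \<rightarrow>\<^sub>E UNIV"

definition network :: "nat \<Rightarrow> ((nat \<Rightarrow> bool) \<Rightarrow> (nat \<Rightarrow> bool)) \<Rightarrow> bool" where
  "network n f \<longleftrightarrow> f \<in> configs n \<rightarrow> configs n"

definition interaction_graph ::
    "nat \<Rightarrow> ((nat \<Rightarrow> bool) \<Rightarrow> (nat \<Rightarrow> bool)) \<Rightarrow> (nat \<times> nat) set" where
  "interaction_graph n f =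
     {(j, i). j \<in> {1..n} \<and> i \<in> {1..n} \<and>
        (\<exists>x\<in>configs n. \<exists>y\<in>configs n.
           (\<forall>k\<in>{1..n}. x k \<noteq> y k \<longleftrightarrow> k = j) \<and> f x i \<noteq> f y i)}"

definition acyclic_network :: "nat \<Rightarrow> ((nat \<Rightarrow> bool) \<Rightarrow> (nat \<Rightarrow> bool)) \<Rightarrow> bool" where
  "acyclic_network n f \<longleftrightarrow> network n f \<and> acyclic (interaction_graph n f)"

definition update :: "((nat \<Rightarrow> bool) \<Rightarrow> (nat \<Rightarrow> bool)) \<Rightarrow> nat \<Rightarrow> (nat \<Rightarrow> bool) \<Rightarrow> (nat \<Rightarrow> bool)" where
  "update f i x = x(i := f x i)"

text \<open>The first letter of the word is applied first.\<close>

definition update_word ::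
    "((nat \<Rightarrow> bool) \<Rightarrow> (nat \<Rightarrow> bool)) \<Rightarrow> nat list \<Rightarrow> (nat \<Rightarrow> bool) \<Rightarrow> (nat \<Rightarrow> bool)" where
  "update_word f w = fold (update f) w"

definition word_fixes :: "nat \<Rightarrow> nat list \<Rightarrow> ((nat \<Rightarrow> bool) \<Rightarrow> (nat \<Rightarrow> bool)) \<Rightarrow> bool" where
  "word_fixes n w f \<longleftrightarrow> (\<forall>x\<in>configs n. f (update_word f w x) = update_word f w x)"

definition fixes_all_acyclic :: "nat \<Rightarrow> nat list \<Rightarrow> bool" where
  "fixes_all_acyclic n w \<longleftrightarrow> (\<forall>f. acyclic_network n f \<longrightarrow> word_fixes n w f)"

definition complete_word :: "nat \<Rightarrow> nat list \<Rightarrow> bool" where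
  "complete_word n w \<longleftrightarrow> (\<forall>p\<in>permutations_of_set {1..n}. subseq p w)"

definition lambda_A :: "nat \<Rightarrow> nat" where
  "lambda_A n = (LEAST k. \<exists>w\<in>lists {1..n}. length w = k \<and> fixes_all_acyclic n w)"

definition lambda :: "nat \<Rightarrow> nat" where
  "lambda n = (LEAST k. \<exists>w\<in>lists {1..n}. length w = k \<and> complete_word n w)"

text \<open>
  The minimum defining \<^const>\<open>lambda\<close> ranges over a nonempty set.
\<close>

lemma subseq_concat_replicate:
  "set xs \<subseteq> set ys \<Longrightarrow> subseq xs (concat (replicate (length xs) ys))"
proof (induction xs)
  case Nil
  show ?case by simp
next
  case (Cons x xs)
  from Cons.prems have "subseq [x] ys"
    by (simp add: subseq_singleton_left)
  moreover from Cons have "subseq xs (concat (replicate (length xs) ys))"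
    by simp
  ultimately have "subseq ([x] @ xs) (ys @ concat (replicate (length xs) ys))"
    by (rule list_emb_append_mono)
  then show ?case by simp
qed

lemma complete_word_exists: "\<exists>w\<in>lists {1..n}. complete_word n w"
proof -
  obtain ys where ys: "set ys = {1..n}"
    using finite_list[of "{1..n}"] by auto
  let ?w = "concat (replicate n ys)"
  have "?w \<in> lists {1..n}"
    by (simp add: in_lists_conv_set ys)
  moreover have "subseq p ?w" if "p \<in> permutations_of_set {1..n}" for p
  proof -
    from that have "set p = {1..n}" and "length p = n"
      by (auto simp: permutations_of_set_def dest: distinct_card)
    with subseq_concat_replicate[of p ys] ys show ?thesis
      by simp
  qed
  ultimately show ?thesis
    unfolding complete_word_def by blast
qed

end

theory Submission
  imports Defs
begin

text \<open>
  Call a component settled in \<open>x\<close> if \<open>f x\<close> agrees with \<open>x\<close> there. A predecessor-closed set of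
  settled components stays settled under every update, and updating a component all of whose
  predecessors are settled settles it too; so any word containing a topological order of the
  interaction graph fixes \<open>f\<close>. Conversely, for a permutation \<open>p\<close> consider the path network in which
  the first component of \<open>p\<close> is constantly true and every other one copies its predecessor in \<open>p\<close>.
  Started from the all-false configuration, it reaches its only fixed point, the all-true
  configuration, only along words that contain \<open>p\<close>.
\<close>

section \<open>Topological orders of finite acyclic relations\<close>

lemma exists_topological_order:
  assumes "finite r" "acyclic r" "finite A"
  obtains p where "distinct p" "set p = A" "sorted_wrt (\<lambda>a b. (b, a) \<notin> r) p"
proof -
  have "\<exists>p. distinct p \<and> set p = A \<and> sorted_wrt (\<lambda>a b. (b, a) \<notin> r) p"
    using \<open>finite A\<close>
  proof (induction A rule: finite_remove_induct)
    case empty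
    then show ?case by simp
  next
    case (remove B)
    have "wf r"
      using assms by (simp add: finite_acyclic_wf)
    \<comment> \<open>A minimal \<open>a\<close> has no predecessor in \<open>B\<close>, so it can
      stand in front of any order of the rest.\<close>
    then obtain a where a: "a \<in> B" "\<And>b. (b, a) \<in> r \<Longrightarrow> b \<notin> B"
      using remove.hyps(2) by (metis ex_in_conv wfE_min)
    from remove.IH[OF a(1)] obtain p
      where "distinct p" "set p = B - {a}" "sorted_wrt (\<lambda>a b. (b, a) \<notin> r) p"
      by blast
    with a have "distinct (a # p) \<and> set (a # p) = B \<and> sorted_wrt (\<lambda>a b. (b, a) \<notin> r) (a # p)"
      by auto
    then show ?case by blast
  qed
  with that show thesis by blast
qed

section \<open>Single updates and the interaction graph\<close>

lemma finite_interaction_graph: "finite (interaction_graph n f)"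
  by (rule finite_subset[of _ "{1..n} \<times> {1..n}"]) (auto simp: interaction_graph_def)

lemma interaction_graph_subset: "(j, i) \<in> interaction_graph n f \<Longrightarrow> j \<in> {1..n}"
  by (simp add: interaction_graph_def)

lemma update_in_configs:
  assumes "network n f" "x \<in> configs n" "i \<in> {1..n}"
  shows "update f i x \<in> configs n"
  using assms by (auto simp: update_def configs_def PiE_iff extensional_def)

lemma update_word_in_configs:
  assumes "network n f" "x \<in> configs n" "w \<in> lists {1..n}"
  shows "update_word f w x \<in> configs n"
  using assms(3,2)
proof (induction w arbitrary: x)
  case (Cons i w)
  then show ?case
    using update_in_configs[OF assms(1)] by (simp add: update_word_def)
qed (simp add: update_word_def)

text \<open>Either the update changes nothing, or the two configurations differ exactly at
  \<open>k\<close> and a change of \<open>f\<close> at \<open>i\<close> would witness the edge from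
  \<open>k\<close> to \<open>i\<close>.\<close>

lemma component_unaffected_by_update:
  assumes "network n f" "x \<in> configs n" "k \<in> {1..n}" "i \<in> {1..n}"
    and "(k, i) \<notin> interaction_graph n f"
  shows "f (update f k x) i = f x i"
proof (cases "f x k = x k")
  case True
  then show ?thesis by (simp add: update_def fun_upd_idem)
next
  case False
  then have "\<forall>j\<in>{1..n}. x j \<noteq> update f k x j \<longleftrightarrow> j = k"
    by (auto simp: update_def)
  with assms update_in_configs[OF assms(1-3)] show ?thesis
    unfolding interaction_graph_def by blast
qed

section \<open>Settled components\<close>

definition settled :: "((nat \<Rightarrow> bool) \<Rightarrow> (nat \<Rightarrow> bool)) \<Rightarrow> nat set \<Rightarrow> (nat \<Rightarrow> bool) \<Rightarrow> bool" where
  "settled f S x \<longleftrightarrow> (\<forall>i\<in>S. f x i = x i)"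

text \<open>Updating a settled \<open>k\<close> is the identity. A \<open>k\<close> outside the
  predecessor-closed \<open>S\<close> has no edge into \<open>S\<close>.\<close>

lemma settled_update:
  assumes "network n f" "x \<in> configs n" "k \<in> {1..n}" "S \<subseteq> {1..n}"
    and closed: "\<And>i j. i \<in> S \<Longrightarrow> (j, i) \<in> interaction_graph n f \<Longrightarrow> j \<in> S"
    and settled: "settled f S x"
  shows "settled f S (update f k x)"
proof (cases "k \<in> S")
  case True
  with settled have "update f k x = x"
    by (simp add: settled_def update_def fun_upd_idem)
  with settled show ?thesis by simp
next
  case False
  show ?thesis
    unfolding settled_def
  proof
    fix i assume i: "i \<in> S"
    with False closed have "(k, i) \<notin> interaction_graph n f" by blast
    with assms(1-4) i have "f (update f k x) i = f x i"
      by (intro component_unaffected_by_update) auto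
    with settled i False show "f (update f k x) i = update f k x i"
      by (auto simp: settled_def update_def)
  qed
qed

text \<open>Without a loop at \<open>k\<close>, writing \<open>f x k\<close> into component
  \<open>k\<close> leaves the value of \<open>f\<close> there as it was. The predecessors of
  \<open>k\<close> matter only to the caller, which needs \<open>insert k S\<close> to be closed
  again.\<close>

lemma settled_insert_update:
  assumes "network n f" "x \<in> configs n" "k \<in> {1..n}" "S \<subseteq> {1..n}"
    and "\<And>i j. i \<in> S \<Longrightarrow> (j, i) \<in> interaction_graph n f \<Longrightarrow> j \<in> S"
    and "settled f S x" "(k, k) \<notin> interaction_graph n f"
  shows "settled f (insert k S) (update f k x)"
proof -
  have "settled f S (update f k x)"
    using assms(1-6) by (rule settled_update)
  moreover have "f (update f k x) k = update f k x k"
    using component_unaffected_by_update[OF assms(1-3,3,7)] by (simp add: update_def)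
  ultimately show ?thesis
    by (simp add: settled_def)
qed

text \<open>Generalized for induction on \<open>w\<close>: \<open>S\<close> collects components
  already settled, \<open>p\<close> is the part of the order still to be matched. Each letter is
  either skipped or moves the head of \<open>p\<close> into \<open>S\<close>.\<close>

lemma settled_update_word:
  assumes "network n f" "x \<in> configs n" "w \<in> lists {1..n}" "subseq p w"
    and "S \<subseteq> {1..n}"
    and "\<And>i j. i \<in> S \<Longrightarrow> (j, i) \<in> interaction_graph n f \<Longrightarrow> j \<in> S"
    and "sorted_wrt (\<lambda>a b. (b, a) \<notin> interaction_graph n f) p"
    and "\<And>i. (i, i) \<notin> interaction_graph n f"
    and "\<And>i j. i \<in> set p \<Longrightarrow> (j, i) \<in> interaction_graph n f \<Longrightarrow> j \<in> S \<union> set p"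
    and "settled f S x"
  shows "settled f (S \<union> set p) (update_word f w x)"
  using assms(2-)
proof (induction w arbitrary: p S x)
  case Nil
  from Nil.prems(3) have "p = []" by simp
  with Nil.prems(9) show ?case by (simp add: update_word_def)
next
  case (Cons b w)
  have b: "b \<in> {1..n}" and w: "w \<in> lists {1..n}"
    using Cons.prems(2) by auto
  have step: "update_word f (b # w) x = update_word f w (update f b x)"
    by (simp add: update_word_def)
  note configs' = update_in_configs[OF assms(1) Cons.prems(1) b]
  show ?case
  proof (cases "subseq p w")
    case True
    have "settled f S (update f b x)"
      using assms(1) Cons.prems(1) b Cons.prems(4,5,9) by (rule settled_update)
    with configs' w True Cons.prems(4-8) show ?thesis
      unfolding step by (rule Cons.IH)
  next
    case False
    \<comment> \<open>Since \<open>p\<close> embeds in \<open>b # w\<close> but not in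
      \<open>w\<close>, the letter \<open>b\<close> must match its head.\<close>
    with Cons.prems(3) obtain p' where p: "p = b # p'" "subseq p' w"
      by (cases p) (auto split: if_splits)
    \<comment> \<open>A predecessor of \<open>b\<close> lies in \<open>S\<close> or
      \<open>p\<close>; it is not \<open>b\<close>, as there are no loops, and the order excludes
      later letters.\<close>
    have preds: "j \<in> S" if "(j, b) \<in> interaction_graph n f" for j
    proof -
      have "j \<noteq> b" "j \<notin> set p'"
        using that Cons.prems(6,7) by (auto simp: p)
      with Cons.prems(8)[of b j] that show ?thesis
        by (simp add: p)
    qed
    have "settled f (insert b S) (update f b x)"
      using assms(1) Cons.prems(1) b Cons.prems(4,5,9,7) by (rule settled_insert_update)
    then have "settled f (insert b S \<union> set p') (update_word f w (update f b x))"
    proof (rule Cons.IH[OF configs' w p(2), rotated -1])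
      show "insert b S \<subseteq> {1..n}"
        using Cons.prems(4) b by simp
      show "j \<in> insert b S" if "i \<in> insert b S" "(j, i) \<in> interaction_graph n f" for i j
        using that preds Cons.prems(5) by blast
      show "j \<in> insert b S \<union> set p'" if "i \<in> set p'" "(j, i) \<in> interaction_graph n f" for i j
        using that Cons.prems(8)[of i j] by (auto simp: p)
      show "sorted_wrt (\<lambda>a b. (b, a) \<notin> interaction_graph n f) p'"
        using Cons.prems(6) by (simp add: p)
    qed (rule Cons.prems(7))
    then show ?thesis
      by (simp add: step p)
  qed
qed

section \<open>Complete words fix acyclic networks\<close>

lemma complete_word_imp_fixes_all_acyclic:
  assumes "w \<in> lists {1..n}" "complete_word n w"
  shows "fixes_all_acyclic n w"
  unfolding fixes_all_acyclic_def word_fixes_def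
proof (intro allI impI ballI)
  fix f x
  assume "acyclic_network n f" and x: "x \<in> configs n"
  then have f: "network n f" and acyc: "acyclic (interaction_graph n f)"
    by (auto simp: acyclic_network_def)
  obtain p where p: "distinct p" "set p = {1..n}"
      "sorted_wrt (\<lambda>a b. (b, a) \<notin> interaction_graph n f) p"
    using exists_topological_order[OF finite_interaction_graph acyc, of "{1..n}"] by auto
  with assms(2) have "subseq p w"
    by (auto simp: complete_word_def permutations_of_set_def)
  moreover have "(i, i) \<notin> interaction_graph n f" for i
    using acyc by (auto simp: acyclic_def)
  ultimately have "settled f ({} \<union> set p) (update_word f w x)"
    using p by (intro settled_update_word[OF f x assms(1)])
      (auto simp: settled_def dest: interaction_graph_subset)
  then have settled: "settled f {1..n} (update_word f w x)"
    by (simp add: p)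
  have y: "update_word f w x \<in> configs n"
    by (rule update_word_in_configs[OF f x assms(1)])
  with f have "f (update_word f w x) \<in> configs n"
    by (auto simp: network_def)
  \<comment> \<open>Both sides are extensional, so agreement on \<open>{1..n}\<close> is
    equality.\<close>
  with y settled show "f (update_word f w x) = update_word f w x"
    unfolding configs_def settled_def by (intro PiE_ext) auto
qed

section \<open>Path networks\<close>

definition path_network :: "nat \<Rightarrow> nat list \<Rightarrow> (nat \<Rightarrow> bool) \<Rightarrow> (nat \<Rightarrow> bool)" where
  "path_network n p x =
     restrict (\<lambda>i. \<forall>k. Suc k < length p \<and> p ! Suc k = i \<longrightarrow> x (p ! k)) {1..n}"

text \<open>In a distinct \<open>p\<close> exactly one index satisfies the premise of the quantified
  condition, which thus reduces to a copy.\<close>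

lemma path_network_nth_Suc:
  assumes "distinct p" "set p = {1..n}" "Suc k < length p"
  shows "path_network n p x (p ! Suc k) = x (p ! k)"
proof -
  have "p ! Suc k \<in> {1..n}"
    using assms nth_mem by blast
  with assms show ?thesis
    unfolding path_network_def by (auto simp: nth_eq_iff_index_eq)
qed

text \<open>No successor index hits the first letter, so its condition is vacuously true.\<close>

lemma path_network_nth_0:
  assumes "distinct p" "set p = {1..n}" "p \<noteq> []"
  shows "path_network n p x (p ! 0)"
proof -
  have "p ! 0 \<in> {1..n}"
    using assms nth_mem by blast
  with assms show ?thesis
    unfolding path_network_def by (auto simp: nth_eq_iff_index_eq)
qed

text \<open>Every edge advances the position in \<open>p\<close> by one, so a nonempty walk strictly
  increases it and cannot close.\<close>

lemma acyclic_path_network: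
  assumes "distinct p" "set p = {1..n}"
  shows "acyclic_network n (path_network n p)"
proof -
  let ?G = "interaction_graph n (path_network n p)"
  have edge: "\<exists>k. Suc k < length p \<and> a = p ! k \<and> b = p ! Suc k" if ab: "(a, b) \<in> ?G" for a b
  proof -
    from ab obtain x y where b: "b \<in> {1..n}"
      and diff: "\<And>k. k \<in> {1..n} \<Longrightarrow> x k \<noteq> y k \<longleftrightarrow> k = a"
      and xy: "path_network n p x b \<noteq> path_network n p y b"
      unfolding interaction_graph_def by blast
    from xy b obtain k where k: "Suc k < length p" "p ! Suc k = b" "x (p ! k) \<noteq> y (p ! k)"
      by (auto simp: path_network_def)
    moreover from k have "p ! k \<in> {1..n}"
      using assms(2) nth_mem[of k p] by auto
    ultimately show ?thesis
      using diff by blast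
  qed
  have path: "\<exists>k l. k < l \<and> l < length p \<and> a = p ! k \<and> b = p ! l" if "(a, b) \<in> ?G\<^sup>+" for a b
    using that
  proof (induction rule: trancl_induct)
    case (base b)
    then show ?case using edge by blast
  next
    case (step b c)
    from step.IH obtain k l where kl: "k < l" "l < length p" "a = p ! k" "b = p ! l"
      by blast
    from edge[OF step.hyps(2)] obtain m where m: "Suc m < length p" "b = p ! m" "c = p ! Suc m"
      by blast
    from kl m assms(1) have "l = m"
      by (simp add: nth_eq_iff_index_eq)
    with kl m have "k < Suc m \<and> Suc m < length p \<and> a = p ! k \<and> c = p ! Suc m"
      by simp
    then show ?case by blast
  qed
  have "acyclic ?G"
    unfolding acyclic_def
  proof (intro allI notI)
    fix a assume "(a, a) \<in> ?G\<^sup>+"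
    from path[OF this] obtain k l where "k < l" "l < length p" "p ! k = p ! l"
      by auto
    with assms(1) show False
      by (simp add: nth_eq_iff_index_eq)
  qed
  moreover have "network n (path_network n p)"
    by (simp add: network_def configs_def path_network_def)
  ultimately show ?thesis
    by (simp add: acyclic_network_def)
qed

text \<open>Consider the last letter of the word. Unless it is \<open>p ! k\<close>, that component
  was true before. If it is, either \<open>k = 0\<close> or the preceding component was already
  true, and the letter extends the embedded prefix of \<open>p\<close>.\<close>

lemma path_network_true_imp_subseq:
  assumes "distinct p" "set p = {1..n}" "k < length p"
    and "\<And>i. i \<in> {1..n} \<Longrightarrow> \<not> x i"
    and "update_word (path_network n p) w x (p ! k)"
  shows "subseq (take (Suc k) p) w"
  using assms(3,5)
proof (induction w arbitrary: k rule: rev_induct)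
  case Nil
  then show ?case
    using assms(2,4) nth_mem[of k p] by (auto simp: update_word_def)
next
  case (snoc a w)
  let ?y = "update_word (path_network n p) w x"
  have step: "update_word (path_network n p) (w @ [a]) x = update (path_network n p) a ?y"
    by (simp add: update_word_def)
  show ?case
  proof (cases "a = p ! k")
    case False
    with snoc.prems step have "?y (p ! k)"
      by (simp add: update_def)
    from snoc.IH[OF snoc.prems(1) this] show ?thesis
      by (rule list_emb_prefix)
  next
    case True
    have "subseq (take k p) w"
    proof (cases k)
      case 0
      then show ?thesis by simp
    next
      case (Suc m)
      with snoc.prems step True have "?y (p ! m)"
        by (simp add: update_def path_network_nth_Suc[OF assms(1,2)])
      with snoc.IH[of m] snoc.prems(1) Suc show ?thesis
        by simp
    qed
    then have "subseq (take k p @ [a]) (w @ [a])"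
      by (intro list_emb_append_mono) auto
    with True snoc.prems(1) show ?thesis
      by (simp add: take_Suc_conv_app_nth)
  qed
qed

lemma path_network_fixed_point_true:
  assumes "distinct p" "set p = {1..n}" "path_network n p x = x" "k < length p"
  shows "x (p ! k)"
  using assms(4)
proof (induction k)
  case 0
  then show ?case
    using path_network_nth_0[OF assms(1,2), of x] assms(3) by simp
next
  case (Suc k)
  then show ?case
    using path_network_nth_Suc[OF assms(1,2), of k x] assms(3) by simp
qed

section \<open>Words fixing acyclic networks are complete\<close>

lemma fixes_all_acyclic_imp_complete_word:
  assumes "fixes_all_acyclic n w"
  shows "complete_word n w"
  unfolding complete_word_def
proof
  fix p assume "p \<in> permutations_of_set {1..n}"
  then have p: "distinct p" "set p = {1..n}"
    by (auto simp: permutations_of_set_def)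
  show "subseq p w"
  proof (cases "p = []")
    case False
    define x :: "nat \<Rightarrow> bool" where "x = restrict (\<lambda>_. False) {1..n}"
    let ?y = "update_word (path_network n p) w x"
    have "x \<in> configs n"
      by (simp add: x_def configs_def)
    with assms acyclic_path_network[OF p] have "path_network n p ?y = ?y"
      unfolding fixes_all_acyclic_def word_fixes_def by blast
    \<comment> \<open>The last letter is taken so that the embedded prefix is all of
      \<open>p\<close>; this index is valid as \<open>p\<close> is nonempty.\<close>
    then have "?y (p ! (length p - 1))"
      by (rule path_network_fixed_point_true[OF p]) (use False in simp)
    with False have "subseq (take (Suc (length p - 1)) p) w"
      by (intro path_network_true_imp_subseq[OF p, where x = x]) (auto simp: x_def)
    with False show ?thesis by simp
  qed simp
qed

theorem proposition2:
  fixes n :: nat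
  assumes "n \<ge> 1"
  shows "(\<forall>w\<in>lists {1..n}. fixes_all_acyclic n w \<longleftrightarrow> complete_word n w) \<and>
         lambda_A n = lambda n"
proof -
  have eq: "fixes_all_acyclic n w \<longleftrightarrow> complete_word n w" if "w \<in> lists {1..n}" for w
    using that complete_word_imp_fixes_all_acyclic fixes_all_acyclic_imp_complete_word by blast
  \<comment> \<open>Both minima range over the lengths of the same words.\<close>
  then have "lambda_A n = lambda n"
    unfolding lambda_A_def lambda_def by (simp cong: bex_cong)
  with eq show ?thesis by blast
qed

end
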